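(* Let $A$ and $B$ be finitely generated nilpotent groups, let $C_A$ be a proper subgroup of $A$ and $C_B$ a proper subgroup of $B$, and let $\phi: C_A\to C_B$ be an isomorphism. Then the generalized free product $G=\{A * B;\ C_A=C_B\}$ of $A$ and $B$ amalgamating $C_A$ with $C_B$ via $\phi$ is not perfect, i.e. $G\neq [G,G]$.
   Context: The generalized free product (amalgamated product) $\{A*B;\ C_A=C_B\}$ is the quotient of the free product $A*B$ by the normal closure of the elements $c\,(\phi(c))^{-1}$, $c\in C_A$. A group is perfect if it equals its commutator subgroup, equivalently if its abelianization is trivial. *)

theory Defs
  imports "HOL-Algebra.Generated_Groups"
begin

definition finitely_generated_group :: "('a, 'm) monoid_scheme \<Rightarrow> bool" where
  "finitely_generated_group G \<longleftrightarrow>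
     (\<exists>S. finite S \<and> S \<subseteq> carrier G \<and> generate G S = carrier G)"

(* Indexed from 0: lower_central G 0 = G and lower_central G (n + 1) = [lower_central G n, G]. *)
primrec lower_central :: "('a, 'm) monoid_scheme \<Rightarrow> nat \<Rightarrow> 'a set" where
  "lower_central G 0 = carrier G"
| "lower_central G (Suc n) =
     generate G (\<Union>x \<in> lower_central G n. \<Union>g \<in> carrier G.
       {x \<otimes>\<^bsub>G\<^esub> g \<otimes>\<^bsub>G\<^esub> inv\<^bsub>G\<^esub> x \<otimes>\<^bsub>G\<^esub> inv\<^bsub>G\<^esub> g})"

definition nilpotent_group :: "('a, 'm) monoid_scheme \<Rightarrow> bool" where
  "nilpotent_group G \<longleftrightarrow> (\<exists>n. lower_central G n = {\<one>\<^bsub>G\<^esub>})"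

definition perfect_group :: "('a, 'm) monoid_scheme \<Rightarrow> bool" where
  "perfect_group G \<longleftrightarrow> carrier G = derived G (carrier G)"

definition normal_closure :: "('a, 'm) monoid_scheme \<Rightarrow> 'a set \<Rightarrow> 'a set" where
  "normal_closure G S = \<Inter>{N. N \<lhd> G \<and> S \<subseteq> N}"


(* The free product consists of the words with letters from the disjoint union of the two
   carriers, modulo the congruence that multiplies adjacent letters of the same factor and
   deletes identity letters. *)

definition fp_words :: "('a, 'm) monoid_scheme \<Rightarrow> ('b, 'n) monoid_scheme \<Rightarrow> ('a + 'b) list set" where
  "fp_words A B = lists (carrier A <+> carrier B)"

inductive_set fp_rel ::
    "('a, 'm) monoid_scheme \<Rightarrow> ('b, 'n) monoid_scheme \<Rightarrow> (('a + 'b) list \<times> ('a + 'b) list) set"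
  for A :: "('a, 'm) monoid_scheme" and B :: "('b, 'n) monoid_scheme" where
  one_left:   "([Inl \<one>\<^bsub>A\<^esub>], []) \<in> fp_rel A B"
| one_right:  "([Inr \<one>\<^bsub>B\<^esub>], []) \<in> fp_rel A B"
| mult_left:  "\<lbrakk>x \<in> carrier A; y \<in> carrier A\<rbrakk> \<Longrightarrow> ([Inl x, Inl y], [Inl (x \<otimes>\<^bsub>A\<^esub> y)]) \<in> fp_rel A B"
| mult_right: "\<lbrakk>x \<in> carrier B; y \<in> carrier B\<rbrakk> \<Longrightarrow> ([Inr x, Inr y], [Inr (x \<otimes>\<^bsub>B\<^esub> y)]) \<in> fp_rel A B"
| refl:       "w \<in> fp_words A B \<Longrightarrow> (w, w) \<in> fp_rel A B"
| sym:        "(u, v) \<in> fp_rel A B \<Longrightarrow> (v, u) \<in> fp_rel A B"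
| trans:      "\<lbrakk>(u, v) \<in> fp_rel A B; (v, w) \<in> fp_rel A B\<rbrakk> \<Longrightarrow> (u, w) \<in> fp_rel A B"
| append:     "\<lbrakk>(u, u') \<in> fp_rel A B; (v, v') \<in> fp_rel A B\<rbrakk> \<Longrightarrow> (u @ v, u' @ v') \<in> fp_rel A B"

definition free_product ::
    "('a, 'm) monoid_scheme \<Rightarrow> ('b, 'n) monoid_scheme \<Rightarrow> ('a + 'b) list set monoid" where
  "free_product A B =
     \<lparr>carrier = fp_words A B // fp_rel A B,
      mult = (\<lambda>U V. \<Union>u\<in>U. \<Union>v\<in>V. fp_rel A B `` {u @ v}),
      one = fp_rel A B `` {[]}\<rparr>"

definition fp_inl ::
    "('a, 'm) monoid_scheme \<Rightarrow> ('b, 'n) monoid_scheme \<Rightarrow> 'a \<Rightarrow> ('a + 'b) list set" where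
  "fp_inl A B a = fp_rel A B `` {[Inl a]}"

definition fp_inr ::
    "('a, 'm) monoid_scheme \<Rightarrow> ('b, 'n) monoid_scheme \<Rightarrow> 'b \<Rightarrow> ('a + 'b) list set" where
  "fp_inr A B b = fp_rel A B `` {[Inr b]}"

(* The second amalgamated subgroup is the image of C under phi. *)
definition amalgamated_product ::
    "('a, 'm) monoid_scheme \<Rightarrow> ('b, 'n) monoid_scheme \<Rightarrow> 'a set \<Rightarrow> ('a \<Rightarrow> 'b) \<Rightarrow>
       ('a + 'b) list set set monoid" where
  "amalgamated_product A B C \<phi> =
     free_product A B Mod
       normal_closure (free_product A B)
         ((\<lambda>c. fp_inl A B c \<otimes>\<^bsub>free_product A B\<^esub> inv\<^bsub>free_product A B\<^esub> (fp_inr A B (\<phi> c))) ` C)"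


lemma fp_words_simps [simp]:
  "[] \<in> fp_words A B"
  "Inl a # w \<in> fp_words A B \<longleftrightarrow> a \<in> carrier A \<and> w \<in> fp_words A B"
  "Inr b # w \<in> fp_words A B \<longleftrightarrow> b \<in> carrier B \<and> w \<in> fp_words A B"
  "u @ v \<in> fp_words A B \<longleftrightarrow> u \<in> fp_words A B \<and> v \<in> fp_words A B"
  by (auto simp: fp_words_def)

lemma fp_rel_words:
  assumes "group A" "group B" "(u, v) \<in> fp_rel A B"
  shows "u \<in> fp_words A B \<and> v \<in> fp_words A B"
proof -
  interpret A: group A by fact
  interpret B: group B by fact
  show ?thesis using assms(3) by induction auto
qed

lemma equiv_fp_rel:
  assumes "group A" "group B"
  shows "equiv (fp_words A B) (fp_rel A B)"
  by (rule equivI)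
    (use fp_rel_words[OF assms] in
      \<open>auto simp: refl_on_def sym_def trans_def intro: fp_rel.refl fp_rel.sym fp_rel.trans\<close>)

lemma free_product_mult_class:
  assumes "group A" "group B" "u \<in> fp_words A B" "v \<in> fp_words A B"
  shows "fp_rel A B `` {u} \<otimes>\<^bsub>free_product A B\<^esub> fp_rel A B `` {v} = fp_rel A B `` {u @ v}"
proof -
  have eq: "equiv (fp_words A B) (fp_rel A B)" by (rule equiv_fp_rel[OF assms(1,2)])
  have "(\<lambda>u v. fp_rel A B `` {u @ v}) respects2 fp_rel A B"
    by (rule congruent2I') (auto intro!: equiv_class_eq[OF eq] fp_rel.append)
  then show ?thesis
    using UN_equiv_class2[OF eq eq _ assms(3,4)] by (simp add: free_product_def)
qed

lemma free_product_inv_word: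
  assumes "group A" "group B" "w \<in> fp_words A B"
  shows "\<exists>w' \<in> fp_words A B. (w' @ w, []) \<in> fp_rel A B"
proof -
  interpret A: group A by fact
  interpret B: group B by fact
  show ?thesis using assms(3)
  proof (induction w)
    case Nil
    then show ?case by (auto intro!: bexI[of _ "[]"] fp_rel.refl)
  next
    case (Cons l w)
    obtain l' where l': "[l'] \<in> fp_words A B" "([l', l], []) \<in> fp_rel A B"
    proof (cases l)
      case (Inl a)
      with Cons.prems have a: "a \<in> carrier A" by simp
      have "([Inl (inv\<^bsub>A\<^esub> a), Inl a], [Inl \<one>\<^bsub>A\<^esub>]) \<in> fp_rel A B"
        using fp_rel.mult_left[of "inv\<^bsub>A\<^esub> a" A a B] a by simp
      then have "([Inl (inv\<^bsub>A\<^esub> a), Inl a], []) \<in> fp_rel A B"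
        by (rule fp_rel.trans) (rule fp_rel.one_left)
      with Inl a show ?thesis by (intro that[of "Inl (inv\<^bsub>A\<^esub> a)"]) auto
    next
      case (Inr b)
      with Cons.prems have b: "b \<in> carrier B" by simp
      have "([Inr (inv\<^bsub>B\<^esub> b), Inr b], [Inr \<one>\<^bsub>B\<^esub>]) \<in> fp_rel A B"
        using fp_rel.mult_right[of "inv\<^bsub>B\<^esub> b" B b A] b by simp
      then have "([Inr (inv\<^bsub>B\<^esub> b), Inr b], []) \<in> fp_rel A B"
        by (rule fp_rel.trans) (rule fp_rel.one_right)
      with Inr b show ?thesis by (intro that[of "Inr (inv\<^bsub>B\<^esub> b)"]) auto
    qed
    have "w \<in> fp_words A B" using Cons.prems by (auto simp: fp_words_def)
    with Cons.IH obtain w' where w': "w' \<in> fp_words A B" "(w' @ w, []) \<in> fp_rel A B" by blast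
    have "(w' @ ([l', l] @ w), w' @ ([] @ w)) \<in> fp_rel A B"
      using w' \<open>w \<in> fp_words A B\<close> l' by (intro fp_rel.append fp_rel.refl) auto
    then have "((w' @ [l']) @ l # w, []) \<in> fp_rel A B"
      using w'(2) by (auto intro: fp_rel.trans)
    with w' l' show ?case by (intro bexI[of _ "w' @ [l']"]) auto
  qed
qed

lemma group_free_product:
  assumes "group A" "group B"
  shows "group (free_product A B)"
proof (rule groupI)
  note mc = free_product_mult_class[OF assms]
  have carr: "carrier (free_product A B) = fp_words A B // fp_rel A B"
    and one: "\<one>\<^bsub>free_product A B\<^esub> = fp_rel A B `` {[]}"
    by (simp_all add: free_product_def)
  show "\<one>\<^bsub>free_product A B\<^esub> \<in> carrier (free_product A B)"
    unfolding carr one by (rule quotientI) simp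
  fix P assume "P \<in> carrier (free_product A B)"
  then obtain u where u: "u \<in> fp_words A B" "P = fp_rel A B `` {u}"
    unfolding carr by (auto elim!: quotientE)
  show "\<one>\<^bsub>free_product A B\<^esub> \<otimes>\<^bsub>free_product A B\<^esub> P = P"
    unfolding one u(2) using u(1) by (simp add: mc)
  obtain w where w: "w \<in> fp_words A B" "(w @ u, []) \<in> fp_rel A B"
    using free_product_inv_word[OF assms u(1)] by blast
  have "fp_rel A B `` {w} \<otimes>\<^bsub>free_product A B\<^esub> P = \<one>\<^bsub>free_product A B\<^esub>"
    unfolding one u(2) using u(1) w
    by (auto simp: mc intro!: equiv_class_eq[OF equiv_fp_rel[OF assms]])
  then show "\<exists>Q \<in> carrier (free_product A B). Q \<otimes>\<^bsub>free_product A B\<^esub> P = \<one>\<^bsub>free_product A B\<^esub>"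
    unfolding carr using w(1) by (blast intro: quotientI)
  fix Q assume "Q \<in> carrier (free_product A B)"
  then obtain v where v: "v \<in> fp_words A B" "Q = fp_rel A B `` {v}"
    unfolding carr by (auto elim!: quotientE)
  show "P \<otimes>\<^bsub>free_product A B\<^esub> Q \<in> carrier (free_product A B)"
    unfolding carr u(2) v(2) using u(1) v(1) by (auto simp: mc intro: quotientI)
  fix R assume "R \<in> carrier (free_product A B)"
  then obtain w where w: "w \<in> fp_words A B" "R = fp_rel A B `` {w}"
    unfolding carr by (auto elim!: quotientE)
  show "P \<otimes>\<^bsub>free_product A B\<^esub> Q \<otimes>\<^bsub>free_product A B\<^esub> R =
        P \<otimes>\<^bsub>free_product A B\<^esub> (Q \<otimes>\<^bsub>free_product A B\<^esub> R)"
    unfolding u(2) v(2) w(2) using u(1) v(1) w(1) by (simp add: mc)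
qed

lemma fp_inl_hom:
  assumes "group A" "group B"
  shows "fp_inl A B \<in> hom A (free_product A B)"
proof (rule homI)
  interpret A: group A by fact
  fix x y assume "x \<in> carrier A" "y \<in> carrier A"
  then show "fp_inl A B (x \<otimes>\<^bsub>A\<^esub> y) = fp_inl A B x \<otimes>\<^bsub>free_product A B\<^esub> fp_inl A B y"
    by (auto simp: fp_inl_def free_product_mult_class[OF assms]
        intro!: equiv_class_eq[OF equiv_fp_rel[OF assms]] fp_rel.sym[OF fp_rel.mult_left])
qed (auto simp: fp_inl_def free_product_def intro: quotientI)

lemma fp_inr_hom:
  assumes "group A" "group B"
  shows "fp_inr A B \<in> hom B (free_product A B)"
proof (rule homI)
  interpret B: group B by fact
  fix x y assume "x \<in> carrier B" "y \<in> carrier B"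
  then show "fp_inr A B (x \<otimes>\<^bsub>B\<^esub> y) = fp_inr A B x \<otimes>\<^bsub>free_product A B\<^esub> fp_inr A B y"
    by (auto simp: fp_inr_def free_product_mult_class[OF assms]
        intro!: equiv_class_eq[OF equiv_fp_rel[OF assms]] fp_rel.sym[OF fp_rel.mult_right])
qed (auto simp: fp_inr_def free_product_def intro: quotientI)

lemma free_product_universal:
  assumes "group A" "group B" "group H" "f \<in> hom A H" "g \<in> hom B H"
  shows "\<exists>h \<in> hom (free_product A B) H.
           (\<forall>a \<in> carrier A. h (fp_inl A B a) = f a) \<and> (\<forall>b \<in> carrier B. h (fp_inr A B b) = g b)"
proof -
  interpret H: group H by fact
  interpret f: group_hom A H f
    using assms by (simp add: group_hom_def group_hom_axioms_def)
  interpret g: group_hom B H g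
    using assms by (simp add: group_hom_def group_hom_axioms_def)
  have eq: "equiv (fp_words A B) (fp_rel A B)" by (rule equiv_fp_rel[OF assms(1,2)])
  define ev where "ev w = foldr (\<lambda>l z. case_sum f g l \<otimes>\<^bsub>H\<^esub> z) w \<one>\<^bsub>H\<^esub>" for w
  have ev_closed: "ev w \<in> carrier H" if "w \<in> fp_words A B" for w
    using that unfolding fp_words_def by (induction w) (auto simp: ev_def)
  have ev_append: "ev (u @ v) = ev u \<otimes>\<^bsub>H\<^esub> ev v"
    if "u \<in> fp_words A B" "v \<in> fp_words A B" for u v
    using that(1)
  proof (induction u)
    case Nil
    then show ?case using ev_closed[OF that(2)] by (simp add: ev_def)
  next
    case (Cons l u)
    then have u: "u \<in> fp_words A B" and "case_sum f g l \<in> carrier H"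
      by (auto simp: fp_words_def)
    then show ?case
      using Cons.IH[OF u] ev_closed[OF u] ev_closed[OF that(2)]
      by (simp add: ev_def H.m_assoc)
  qed
  have ev_rel: "ev u = ev v" if "(u, v) \<in> fp_rel A B" for u v
    using that
  proof induction
    case (append u u' v v')
    then show ?case using fp_rel_words[OF assms(1,2)] by (metis ev_append)
  qed (auto simp: ev_def H.m_assoc)
  define h where "h P = ev (SOME w. w \<in> P)" for P
  have h_class: "h (fp_rel A B `` {w}) = ev w" if "w \<in> fp_words A B" for w
  proof -
    have "w \<in> fp_rel A B `` {w}" using that by (auto intro: fp_rel.refl)
    then have "(SOME w'. w' \<in> fp_rel A B `` {w}) \<in> fp_rel A B `` {w}" by (rule someI)
    then show ?thesis unfolding h_def using ev_rel[of w] by simp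
  qed
  have "h \<in> hom (free_product A B) H"
  proof (rule homI)
    fix P assume "P \<in> carrier (free_product A B)"
    then obtain u where u: "u \<in> fp_words A B" "P = fp_rel A B `` {u}"
      by (auto simp: free_product_def elim!: quotientE)
    then show "h P \<in> carrier H" by (simp add: h_class ev_closed)
    fix Q assume "Q \<in> carrier (free_product A B)"
    then obtain v where v: "v \<in> fp_words A B" "Q = fp_rel A B `` {v}"
      by (auto simp: free_product_def elim!: quotientE)
    show "h (P \<otimes>\<^bsub>free_product A B\<^esub> Q) = h P \<otimes>\<^bsub>H\<^esub> h Q"
      using u v by (simp add: free_product_mult_class[OF assms(1,2)] h_class ev_append)
  qed
  moreover have "\<forall>a \<in> carrier A. h (fp_inl A B a) = f a"
    by (simp add: fp_inl_def h_class) (simp add: ev_def)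
  moreover have "\<forall>b \<in> carrier B. h (fp_inr A B b) = g b"
    by (simp add: fp_inr_def h_class) (simp add: ev_def)
  ultimately show ?thesis by blast
qed

lemma free_product_generated:
  assumes "group A" "group B"
  shows "generate (free_product A B) (fp_inl A B ` carrier A \<union> fp_inr A B ` carrier B) =
         carrier (free_product A B)"
    (is "generate ?F ?S = _")
proof (rule antisym)
  interpret F: group ?F by (rule group_free_product[OF assms])
  have "?S \<subseteq> carrier ?F"
    using fp_inl_hom[OF assms] fp_inr_hom[OF assms] by (auto simp: hom_def)
  then show "generate ?F ?S \<subseteq> carrier ?F" by (rule F.generate_incl)
  have word: "fp_rel A B `` {w} \<in> generate ?F ?S" if "w \<in> fp_words A B" for w
    using that
  proof (induction w)
    case Nil
    then show ?case
      using generate.one[of ?F ?S] by (simp add: free_product_def)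
  next
    case (Cons l w)
    then have l: "[l] \<in> fp_words A B" and w: "w \<in> fp_words A B" by (auto simp: fp_words_def)
    have "fp_rel A B `` {[l]} \<in> generate ?F ?S"
      using l by (cases l) (auto simp: fp_inl_def fp_inr_def intro!: generate.incl)
    from generate.eng[OF this Cons.IH[OF w]] show ?case
      by (simp add: free_product_mult_class[OF assms l w])
  qed
  then show "carrier ?F \<subseteq> generate ?F ?S"
    by (auto simp: free_product_def elim!: quotientE)
qed

lemma normal_closure_normal:
  assumes "group G" "S \<subseteq> carrier G"
  shows "normal_closure G S \<lhd> G"
proof -
  interpret G: group G by fact
  let ?N = "{N. N \<lhd> G \<and> S \<subseteq> N}"
  have ne: "carrier G \<in> ?N" using assms(2) G.normal_self by simp
  have "subgroup (\<Inter>?N) G"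
    by (rule G.subgroups_Inter) (use ne in \<open>auto simp: normal_def\<close>)
  then show ?thesis
    unfolding normal_closure_def G.normal_inv_iff by (auto simp: G.normal_inv_iff)
qed

lemma group_amalgamated_product:
  assumes "group A" "group B" "C \<subseteq> carrier A" "\<phi> ` C \<subseteq> carrier B"
  shows "group (amalgamated_product A B C \<phi>)"
proof -
  interpret F: group "free_product A B" by (rule group_free_product[OF assms(1,2)])
  show ?thesis
    unfolding amalgamated_product_def
    by (intro normal.factorgroup_is_group normal_closure_normal F.group_axioms)
      (use assms fp_inl_hom[OF assms(1,2)] fp_inr_hom[OF assms(1,2)] in \<open>auto simp: hom_def Pi_iff intro!: F.m_closed F.inv_closed\<close>)
qed

end

theory Submission
  imports Defs "HOL-Algebra.SndIsomorphismGrp"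
begin

text \<open>In a nilpotent group \<open>A\<close> with a proper subgroup \<open>C\<close>, let \<open>k\<close> be the last index for which the
  \<open>k\<close>-th term of the lower central series together with \<open>C\<close> still generates \<open>A\<close>. The next term
  times \<open>C\<close> is then a proper subgroup \<open>D\<close> containing \<open>C\<close>; it is normal with abelian quotient,
  because modulo \<open>D\<close> every element of \<open>A\<close> is congruent to one of the \<open>k\<close>-th term, which is central
  modulo the next one. Sending \<open>B\<close> to the identity extends \<open>A \<rightarrow> A/D\<close> to an epimorphism from the
  amalgamated product onto a nontrivial abelian group.\<close>

text \<open>Cancellation inside right-nested products; with \<open>m_assoc\<close> and
  \<open>inv_mult_group\<close> it settles the commutator identities below.\<close>

lemma (in group) mult_inv_cancel_left:
  assumes "a \<in> carrier G" "z \<in> carrier G"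
  shows "inv a \<otimes> (a \<otimes> z) = z" and "a \<otimes> (inv a \<otimes> z) = z"
  using assms by (simp_all add: m_assoc[symmetric])

text \<open>Conjugation sends [x, g] to the commutator of the conjugates, and the conjugate of x
  stays in the previous term by induction. So the generating set of each term is closed under
  conjugation.\<close>

lemma (in group) lower_central_normal: "lower_central G n \<lhd> G"
proof (induction n)
  case 0
  show ?case by (simp add: normal_self)
next
  case (Suc n)
  interpret N: normal "lower_central G n" G by fact
  show ?case unfolding lower_central.simps
  proof (rule normal_generateI, safe)
    fix x g a assume x: "x \<in> lower_central G n" and g: "g \<in> carrier G" and a: "a \<in> carrier G"
    have xc: "x \<in> carrier G" using x by (rule N.mem_carrier)
    show "x \<otimes> g \<otimes> inv x \<otimes> inv g \<in> carrier G" using xc g by simp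
    have "a \<otimes> (x \<otimes> g \<otimes> inv x \<otimes> inv g) \<otimes> inv a =
      (a \<otimes> x \<otimes> inv a) \<otimes> (a \<otimes> g \<otimes> inv a) \<otimes> inv (a \<otimes> x \<otimes> inv a) \<otimes> inv (a \<otimes> g \<otimes> inv a)"
      using xc g a by (simp add: m_assoc inv_mult_group mult_inv_cancel_left)
    moreover have "a \<otimes> x \<otimes> inv a \<in> lower_central G n" using a x by (rule N.inv_op_closed2)
    moreover have "a \<otimes> g \<otimes> inv a \<in> carrier G" using a g by simp
    ultimately show "a \<otimes> (x \<otimes> g \<otimes> inv x \<otimes> inv g) \<otimes> inv a \<in>
      (\<Union>x\<in>lower_central G n. \<Union>g\<in>carrier G. {x \<otimes> g \<otimes> inv x \<otimes> inv g})" by blast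
  qed
qed

text \<open>Write x = gc with g in \<open>K\<close> and c in \<open>E\<close>. Conjugation by c
  preserves \<open>E\<close>, and conjugation by g changes an element only by a factor in
  \<open>E\<close>, by \<open>comm\<close>. Hence \<open>E\<close> is normal; then c too acts
  trivially modulo \<open>E\<close>, so the quotient is abelian.\<close>

lemma (in group) normal_with_abelian_quotient_if_central_supplement:
  assumes E: "subgroup E G" and K: "K \<subseteq> carrier G" and cover: "K <#> E = carrier G"
    and comm: "\<And>g x. \<lbrakk>g \<in> K; x \<in> carrier G\<rbrakk> \<Longrightarrow> g \<otimes> x \<otimes> inv g \<otimes> inv x \<in> E"
  shows "E \<lhd> G" and "derived G (carrier G) \<subseteq> E"
proof -
  interpret E: subgroup E G by fact
  have decomp: "\<exists>g \<in> K. \<exists>c \<in> E. x = g \<otimes> c" if "x \<in> carrier G" for x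
    using that cover unfolding set_mult_def by blast
  show normal: "E \<lhd> G"
    unfolding normal_inv_iff
  proof (intro conjI E ballI)
    fix x h assume x: "x \<in> carrier G" and h: "h \<in> E"
    obtain g c where gc: "g \<in> K" "c \<in> E" "x = g \<otimes> c" using decomp[OF x] by blast
    have carr: "g \<in> carrier G" "c \<in> carrier G" "h \<in> carrier G"
      using gc h K E.subset by auto
    define z where "z = c \<otimes> h \<otimes> inv c"
    have z: "z \<in> E" using gc h by (simp add: z_def)
    have "x \<otimes> h \<otimes> inv x = (g \<otimes> z \<otimes> inv g \<otimes> inv z) \<otimes> z"
      using carr gc(3) by (simp add: z_def m_assoc inv_mult_group mult_inv_cancel_left)
    with comm[OF gc(1), of z] z show "x \<otimes> h \<otimes> inv x \<in> E" by simp
  qed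
  interpret E: normal E G by fact
  have "x \<otimes> y \<otimes> inv x \<otimes> inv y \<in> E" if x: "x \<in> carrier G" and y: "y \<in> carrier G" for x y
  proof -
    obtain g c where gc: "g \<in> K" "c \<in> E" "x = g \<otimes> c" using decomp[OF x] by blast
    have carr: "g \<in> carrier G" "c \<in> carrier G" using gc K E.subset by auto
    \<comment> \<open>With this z, [x, y] = [g, z] (z y^-1). The first factor is in \<open>E\<close>
      by \<open>comm\<close>, the second because c is in \<open>E\<close> and \<open>E\<close> is
      normal.\<close>
    define z where "z = c \<otimes> y \<otimes> inv c"
    have z: "z \<in> carrier G" using carr y by (simp add: z_def)
    have "z \<otimes> inv y = c \<otimes> (y \<otimes> inv c \<otimes> inv y)" using carr y by (simp add: z_def m_assoc)
    also have "\<dots> \<in> E" using gc(2) y E.inv_op_closed2[of y "inv c"] by simp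
    finally have "z \<otimes> inv y \<in> E" .
    moreover have "x \<otimes> y \<otimes> inv x \<otimes> inv y = (g \<otimes> z \<otimes> inv g \<otimes> inv z) \<otimes> (z \<otimes> inv y)"
      using carr gc(3) y by (simp add: z_def m_assoc inv_mult_group mult_inv_cancel_left)
    ultimately show ?thesis using comm[OF gc(1) z] by simp
  qed
  then show "derived G (carrier G) \<subseteq> E"
    unfolding derived_def by (intro generate_subgroup_incl E) auto
qed

lemma (in group) nilpotent_proper_subgroup_in_normal:
  assumes "nilpotent_group G" and C: "subgroup C G" "C \<noteq> carrier G"
  obtains D where "D \<lhd> G" "C \<subseteq> D" "derived G (carrier G) \<subseteq> D" "D \<noteq> carrier G"
proof -
  interpret C: subgroup C G by fact
  let ?L = "lower_central G"
  obtain n where n: "?L n = {\<one>}" using assms(1) unfolding nilpotent_group_def by blast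
  have "?L n <#> C \<noteq> carrier G"
    using C(2) C.subset by (auto simp: n set_mult_def subset_iff)
  moreover have "?L 0 <#> C = carrier G"
    using C.one_closed C.subset
    by (auto simp: set_mult_def)
  \<comment> \<open>The product with \<open>C\<close> is the whole group at index 0 and only
    \<open>C\<close> at index n, so equality is lost between two consecutive indices.\<close>
  ultimately obtain k where k: "?L k <#> C = carrier G" "?L (Suc k) <#> C \<noteq> carrier G"
    by (induction n) auto
  define D where "D = ?L (Suc k) <#> C"
  interpret L: normal "?L (Suc k)" G by (rule lower_central_normal)
  interpret second_isomorphism_grp "?L (Suc k)" G C
    by unfold_locales
  have sub: "subgroup D G" unfolding D_def by (rule normal_set_mult_subgroup)
  have CD: "C \<subseteq> D"
    using L.one_closed C.subset unfolding D_def set_mult_def by (force intro: l_one[symmetric])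
  have LD: "?L (Suc k) \<subseteq> D"
    using C.one_closed L.subset unfolding D_def set_mult_def by (force intro: r_one[symmetric])
  have Lk: "?L k \<subseteq> carrier G"
    using lower_central_normal[of k] by (simp add: normal_imp_subgroup subgroup.subset)
  \<comment> \<open>\<open>?L k\<close> is central only modulo \<open>?L (Suc k)\<close>, which lies
    in \<open>D\<close> but perhaps not in \<open>C\<close>; so the supplement \<open>C\<close> is
    enlarged to \<open>D\<close>.\<close>
  have "?L k <#> C \<subseteq> ?L k <#> D" using CD by (rule mono_set_mult[OF order_refl])
  then have cover: "?L k <#> D = carrier G"
    using k(1) set_mult_closed[OF Lk subgroup.subset[OF sub]] by auto
  have comm: "g \<otimes> x \<otimes> inv g \<otimes> inv x \<in> D" if "g \<in> ?L k" "x \<in> carrier G" for g x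
    by (rule subsetD[OF LD]) (use that in \<open>auto intro!: generate.incl\<close>)
  note D = normal_with_abelian_quotient_if_central_supplement[OF sub Lk cover comm]
  show thesis
    using that[OF D(1) CD D(2)] k(2) unfolding D_def by blast
qed

text \<open>A homomorphism maps the derived subgroup onto the derived subgroup of its image.\<close>

lemma perfect_group_epi:
  assumes "group_hom G H h" "h ` carrier G = carrier H" "perfect_group G"
  shows "perfect_group H"
  using group_hom.derived_img[OF assms(1) order_refl] assms(2,3)
  unfolding perfect_group_def by simp

text \<open>The quotient is abelian, and an abelian perfect group is trivial: its elements are
  images of the derived subgroup, which collapses to the single coset \<open>H\<close>.\<close>

lemma (in normal) perfect_factor_trivial:
  assumes "derived G (carrier G) \<subseteq> H" "perfect_group (G Mod H)"
  shows "H = carrier G"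
proof -
  interpret q: group_hom G "G Mod H" "\<lambda>x. H #> x"
    by (intro group_hom.intro group_hom_axioms.intro is_group factorgroup_is_group r_coset_hom_Mod)
  have "carrier (G Mod H) = (\<lambda>x. H #> x) ` derived G (carrier G)"
    using assms(2) q.derived_img[OF order_refl]
    unfolding perfect_group_def carrier_FactGroup[symmetric] by simp
  also have "\<dots> \<subseteq> {H}"
    using assms(1) coset_join2[OF mem_carrier is_subgroup] by blast
  finally have "H #> x = H" if "x \<in> carrier G" for x
    using that by (auto simp: carrier_FactGroup)
  then show ?thesis
    using subset rcos_self[OF _ is_subgroup] by blast
qed

text \<open>Since \<open>C\<close> lies in \<open>D\<close>, the projection of \<open>A\<close>
  kills \<open>C\<close>, as does the trivial map of \<open>B\<close> composed with
  \<open>\<phi>\<close>. The two maps therefore agree on the amalgamated subgroup and factor through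
  the amalgamated product.\<close>

lemma amalgamated_product_epi_quotient_left:
  assumes A: "group A" and B: "group B" and D: "D \<lhd> A" and "C \<subseteq> D" and \<phi>: "\<phi> ` C \<subseteq> carrier B"
  obtains h where "h \<in> hom (amalgamated_product A B C \<phi>) (A Mod D)"
    "h ` carrier (amalgamated_product A B C \<phi>) = carrier (A Mod D)"
proof -
  let ?F = "free_product A B" and ?Q = "A Mod D"
  interpret D: normal D A by fact
  interpret F: group ?F by (rule group_free_product[OF A B])
  interpret Q: group ?Q by (rule D.factorgroup_is_group)
  define S where "S = (\<lambda>c. fp_inl A B c \<otimes>\<^bsub>?F\<^esub> inv\<^bsub>?F\<^esub> (fp_inr A B (\<phi> c))) ` C"
  let ?M = "normal_closure ?F S"
  have "(\<lambda>_. \<one>\<^bsub>?Q\<^esub>) \<in> hom B ?Q"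
    by (rule homI) (use Q.one_closed Q.l_one in \<open>auto simp del: one_FactGroup mult_FactGroup\<close>)
  from free_product_universal[OF A B Q.is_group D.r_coset_hom_Mod this]
  obtain h where h: "h \<in> hom ?F ?Q"
    and hl: "\<And>a. a \<in> carrier A \<Longrightarrow> h (fp_inl A B a) = D #>\<^bsub>A\<^esub> a"
    and hr: "\<And>b. b \<in> carrier B \<Longrightarrow> h (fp_inr A B b) = \<one>\<^bsub>?Q\<^esub>"
    by blast
  interpret h: group_hom ?F ?Q h by unfold_locales (rule h)
  have inl: "fp_inl A B a \<in> carrier ?F" if "a \<in> carrier A" for a
    using that fp_inl_hom[OF A B] by (auto simp: hom_def)
  have inr: "fp_inr A B b \<in> carrier ?F" if "b \<in> carrier B" for b
    using that fp_inr_hom[OF A B] by (auto simp: hom_def)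
  have S_ker: "S \<subseteq> kernel ?F ?Q h"
  proof
    fix s assume "s \<in> S"
    then obtain c where c: "c \<in> C" and s: "s = fp_inl A B c \<otimes>\<^bsub>?F\<^esub> inv\<^bsub>?F\<^esub> (fp_inr A B (\<phi> c))"
      unfolding S_def by blast
    have cD: "c \<in> D" "c \<in> carrier A" "\<phi> c \<in> carrier B"
      using c \<open>C \<subseteq> D\<close> \<phi> D.subset by auto
    have "h s = h (fp_inl A B c) \<otimes>\<^bsub>?Q\<^esub> inv\<^bsub>?Q\<^esub> h (fp_inr A B (\<phi> c))"
      unfolding s using cD by (simp only: h.hom_mult h.hom_inv inl inr F.inv_closed)
    also have "\<dots> = (D #>\<^bsub>A\<^esub> c) \<otimes>\<^bsub>?Q\<^esub> \<one>\<^bsub>?Q\<^esub>"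
      using cD by (simp only: hl hr Q.inv_one)
    also have "D #>\<^bsub>A\<^esub> c = \<one>\<^bsub>?Q\<^esub>"
      using D.coset_join2[OF cD(2) D.is_subgroup cD(1)] by simp
    finally have "h s = \<one>\<^bsub>?Q\<^esub>" using Q.l_one[OF Q.one_closed] by metis
    then show "s \<in> kernel ?F ?Q h"
      using cD unfolding s kernel_def by (simp add: inl inr)
  qed
  \<comment> \<open>The kernel is one of the normal subgroups intersected in the normal
    closure.\<close>
  then have M_ker: "?M \<subseteq> kernel ?F ?Q h"
    unfolding normal_closure_def using h.normal_kernel by blast
  have M: "?M \<lhd> ?F"
    using S_ker by (intro normal_closure_normal F.is_group) (auto simp: kernel_def)
  obtain g where g: "g \<in> hom (?F Mod ?M) ?Q"
    and gh: "\<And>x. x \<in> carrier ?F \<Longrightarrow> g (?M #>\<^bsub>?F\<^esub> x) = h x"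
    using h.FactGroup_universal_kernel[OF M M_ker] by blast
  \<comment> \<open>Every coset of \<open>D\<close> is already hit by the image of
    \<open>A\<close>.\<close>
  have "carrier ?Q \<subseteq> g ` carrier (?F Mod ?M)"
  proof
    fix X assume "X \<in> carrier ?Q"
    then obtain a where a: "a \<in> carrier A" "X = D #>\<^bsub>A\<^esub> a" by (auto simp: carrier_FactGroup)
    then have "X = g (?M #>\<^bsub>?F\<^esub> fp_inl A B a)" by (simp add: gh hl inl)
    then show "X \<in> g ` carrier (?F Mod ?M)" using inl[OF a(1)] by (auto simp: carrier_FactGroup)
  qed
  with g have "g ` carrier (?F Mod ?M) = carrier ?Q" by (auto simp: hom_def)
  with g that show thesis unfolding amalgamated_product_def S_def by blast
qed

theorem theorem1:
  fixes A :: "('a, 'm) monoid_scheme"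
    and B :: "('b, 'n) monoid_scheme"
    and C\<^sub>A :: "'a set" and C\<^sub>B :: "'b set"
    and \<phi> :: "'a \<Rightarrow> 'b"
  assumes "group A" and "finitely_generated_group A" and "nilpotent_group A"
    and "group B" and "finitely_generated_group B" and "nilpotent_group B"
    and "subgroup C\<^sub>A A" and "C\<^sub>A \<noteq> carrier A"
    and "subgroup C\<^sub>B B" and "C\<^sub>B \<noteq> carrier B"
    and "\<phi> \<in> iso (A\<lparr>carrier := C\<^sub>A\<rparr>) (B\<lparr>carrier := C\<^sub>B\<rparr>)"
  shows "\<not> perfect_group (amalgamated_product A B C\<^sub>A \<phi>)"
proof
  let ?G = "amalgamated_product A B C\<^sub>A \<phi>"
  assume perfect: "perfect_group ?G"
  obtain D where D: "D \<lhd> A" "C\<^sub>A \<subseteq> D" "derived A (carrier A) \<subseteq> D" "D \<noteq> carrier A"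
    using group.nilpotent_proper_subgroup_in_normal[OF \<open>group A\<close> \<open>nilpotent_group A\<close>]
      \<open>subgroup C\<^sub>A A\<close> \<open>C\<^sub>A \<noteq> carrier A\<close> by blast
  have \<phi>: "\<phi> ` C\<^sub>A \<subseteq> carrier B"
    using assms(11) subgroup.subset[OF \<open>subgroup C\<^sub>B B\<close>]
    by (auto simp: iso_def bij_betw_def)
  obtain h where h: "h \<in> hom ?G (A Mod D)" "h ` carrier ?G = carrier (A Mod D)"
    using amalgamated_product_epi_quotient_left[OF \<open>group A\<close> \<open>group B\<close> D(1,2) \<phi>] by blast
  have "group ?G"
    using assms(1,4) subgroup.subset[OF \<open>subgroup C\<^sub>A A\<close>] \<phi> by (rule group_amalgamated_product)
  then have "group_hom ?G (A Mod D) h"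
    using normal.factorgroup_is_group[OF D(1)] h(1)
    by (simp add: group_hom_def group_hom_axioms_def)
  \<comment> \<open>The contradiction: \<open>A Mod D\<close> would be perfect, yet it is abelian
    and nontrivial.\<close>
  then have "perfect_group (A Mod D)" using h(2) perfect by (rule perfect_group_epi)
  then show False using normal.perfect_factor_trivial[OF D(1,3)] D(4) by blast
qed

end
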